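(* Let $\psi(x,t)\ge0$ satisfy the nonlinear problem $$\frac{\partial \psi}{\partial t} = D\frac{\partial^2\psi}{\partial x^2}+f(\psi) \quad\text{in } 0<x<L(t),\qquad \psi(0,t)=\psi(L(t),t)=0,$$ where $f$ is of KPP type, i.e. $f$ is Lipschitz continuous, differentiable at $0$, and satisfies $$f(0)=f(1)=0,\qquad f'(0)>0,\qquad \frac{f(k)}{k}\ \text{non-increasing on } k>0,$$ and where there is some $k_0>0$ such that $f(k)<f'(0)k$ for $0<k<k_0$. If $\limsup_{t\to\infty}L(t)\le L_{crit}$, then $\psi(x,t)$ converges uniformly (in $x$) to zero as $t\to\infty$.
   Context: Here $D>0$ is a constant and $L_{crit}=\pi\sqrt{D/f'(0)}$. The function $L(t)$ is a prescribed twice continuously differentiable function of $t\ge0$ with $L(t)>0$ for all $t\ge0$. Solutions $\psi$ are non-negative, and the problem is posed for $t\ge0$. *)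

theory Defs
  imports "HOL-Analysis.Analysis"
begin

text \<open>
  Since solutions are non-negative, only the values of \<open>f\<close> on \<open>[0, \<infinity>)\<close> are relevant. The
  conditions are imposed there, so the derivative \<open>r = f'(0)\<close> is the one-sided one.
\<close>

definition KPP_type :: "(real \<Rightarrow> real) \<Rightarrow> real \<Rightarrow> bool" where
  "KPP_type f r \<longleftrightarrow>
     (\<exists>C. C-lipschitz_on {0..} f) \<and>
     (f has_real_derivative r) (at 0 within {0..}) \<and>
     f 0 = 0 \<and> f 1 = 0 \<and> r > 0 \<and>
     antimono_on {0<..} (\<lambda>k. f k / k)"

definition L_crit :: "real \<Rightarrow> real \<Rightarrow> real" where
  "L_crit D r = pi * sqrt (D / r)"

definition twice_continuously_differentiable_on :: "(real \<Rightarrow> real) \<Rightarrow> real set \<Rightarrow> bool" where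
  "twice_continuously_differentiable_on g S \<longleftrightarrow>
     (\<exists>g' g''. (\<forall>t\<in>S. (g has_real_derivative g' t) (at t within S)) \<and>
               (\<forall>t\<in>S. (g' has_real_derivative g'' t) (at t within S)) \<and>
               continuous_on S g'')"

text \<open>
  Classical solutions of \<open>\<psi>\<^sub>t = D \<psi>\<^sub>x\<^sub>x + f(\<psi>)\<close> on the moving interval \<open>0 < x < L(t)\<close> with zero
  boundary values: continuous up to the boundary and the initial time, with the equation holding
  pointwise for \<open>t > 0\<close>. Continuity of the derivatives is not demanded. Values of
  \<open>\<psi> x t\<close> outside \<open>0 \<le> x \<le> L t\<close>, \<open>t \<ge> 0\<close> are irrelevant.
\<close>

definition moving_domain :: "(real \<Rightarrow> real) \<Rightarrow> (real \<times> real) set" where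
  "moving_domain L = {(x, t). 0 \<le> t \<and> 0 \<le> x \<and> x \<le> L t}"

definition is_solution ::
  "real \<Rightarrow> (real \<Rightarrow> real) \<Rightarrow> (real \<Rightarrow> real) \<Rightarrow> (real \<Rightarrow> real \<Rightarrow> real) \<Rightarrow> bool" where
  "is_solution D f L \<psi> \<longleftrightarrow>
     continuous_on (moving_domain L) (\<lambda>(x, t). \<psi> x t) \<and>
     (\<forall>t\<ge>0. \<psi> 0 t = 0 \<and> \<psi> (L t) t = 0) \<and>
     (\<exists>\<psi>t \<psi>x \<psi>xx. \<forall>t>0. \<forall>x\<in>{0<..<L t}.
        ((\<lambda>s. \<psi> x s) has_real_derivative \<psi>t x t) (at t) \<and>
        ((\<lambda>y. \<psi> y t) has_real_derivative \<psi>x x t) (at x) \<and>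
        ((\<lambda>y. \<psi>x y t) has_real_derivative \<psi>xx x t) (at x) \<and>
        \<psi>t x t = D * \<psi>xx x t + f (\<psi> x t))"

end

theory Submission
  imports Defs
begin

text \<open>
  The solution is trapped below a positive function whose limit is as small as desired. Put
  \<open>\<beta> = sqrt (r / D)\<close>, so that \<open>\<beta> L\<^sub>c\<^sub>r\<^sub>i\<^sub>t = \<pi>\<close> and \<open>sin (\<beta> x)\<close> is the neutral mode of the linearised
  equation on the critical interval. This mode neither decays nor stays positive on a slightly
  longer interval, and \<open>L\<close> may exceed \<open>L\<^sub>c\<^sub>r\<^sub>i\<^sub>t\<close> at all times. It is therefore replaced by
  \<open>\<phi> = C + s (1/2 - 2 C\<^sup>2)\<close> with \<open>C = sin (\<beta> x)\<close> and a small \<open>s > 0\<close>, which satisfies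
  \<open>D \<phi>'' + r \<phi> = r s (6 C\<^sup>2 - 7/2)\<close>. For \<open>C < 3/4\<close>, in particular near both ends, the right-hand
  side is negative and \<open>f(k) \<le> r k\<close> suffices. For \<open>C \<ge> 3/4\<close> it may be positive, but there
  \<open>\<phi> \<ge> 1/2\<close>, so \<open>A \<phi>\<close> with \<open>A \<ge> \<epsilon>\<close> is bounded away from zero, and the gap
  \<open>\<kappa> = r - f(\<epsilon>/2) / (\<epsilon>/2) > 0\<close> absorbs it when \<open>s\<close> is small. Thus
  \<open>D (A \<phi>)'' + f(A \<phi>) \<le> - c A \<phi>\<close> for some \<open>c > 0\<close> and all \<open>A \<ge> \<epsilon>\<close>
  (lemma \<open>profile_supersolution\<close>).

  Moreover \<open>\<phi>\<close> is bounded below by a positive constant on \<open>[0, L\<^sub>c\<^sub>r\<^sub>i\<^sub>t + \<delta>]\<close> for small \<open>\<delta> > 0\<close>, an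
  interval that contains \<open>[0, L(t)]\<close> from some time \<open>T\<close> on. If \<open>A' = - c (A - \<epsilon>)\<close>, the function
  \<open>A(t) \<phi>(x)\<close> is a strict supersolution. With \<open>A(T)\<close> large it dominates \<open>\<psi>\<close> at time \<open>T\<close>, and
  lemma \<open>strict_comparison\<close> keeps it above \<open>\<psi>\<close> ever after. Since \<open>A(t) \<rightarrow> \<epsilon>\<close> and \<open>\<phi> \<le> 2\<close>, the claim
  follows.
\<close>

section \<open>Comparison with strict supersolutions\<close>

lemma local_max_second_derivative_nonpos:
  fixes g g' :: "real \<Rightarrow> real"
  assumes "a < x0" "x0 < b"
    and der: "\<And>x. \<lbrakk>a < x; x < b\<rbrakk> \<Longrightarrow> (g has_real_derivative g' x) (at x)"
    and der2: "(g' has_real_derivative G) (at x0)"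
    and max: "\<And>x. \<lbrakk>a < x; x < b\<rbrakk> \<Longrightarrow> g x \<le> g x0"
  shows "G \<le> 0"
proof (rule ccontr)
  assume "\<not> G \<le> 0"
  then have "G > 0" by simp
  have "g' x0 = 0"
  proof (rule DERIV_local_max[OF der[OF assms(1,2)]])
    show "0 < min (x0 - a) (b - x0)" using assms by simp
    show "\<forall>y. \<bar>x0 - y\<bar> < min (x0 - a) (b - x0) \<longrightarrow> g y \<le> g x0"
      using max by (auto simp: abs_if split: if_splits)
  qed
  obtain d where "d > 0" and d: "\<And>h. \<lbrakk>0 < h; h < d\<rbrakk> \<Longrightarrow> g' x0 < g' (x0 + h)"
    using DERIV_pos_inc_right[OF der2 \<open>G > 0\<close>] by blast
  define x1 where "x1 = x0 + min (d / 2) ((b - x0) / 2)"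
  have x1: "x0 < x1" "x1 < x0 + d" "x1 < b"
    using \<open>d > 0\<close> assms(2) by (auto simp: x1_def min_def field_simps)
  have "g x0 < g x1"
  proof (rule DERIV_pos_imp_increasing_open[OF x1(1)])
    fix x assume x: "x0 < x" "x < x1"
    have "g' x > 0" using d[of "x - x0"] x x1 \<open>g' x0 = 0\<close> by simp
    then show "\<exists>y. (g has_real_derivative y) (at x) \<and> y > 0"
      using der[of x] x x1 assms(1) by auto
  next
    show "continuous_on {x0..x1} g"
      using der assms(1) x1(3)
      by (intro DERIV_continuous_on[where D = g']) (auto intro: has_field_derivative_at_within)
  qed
  then show False using max[of x1] x1 assms(1) by linarith
qed

text \<open>
  The slab is the continuous image of a rectangle under \<open>(u, t) \<mapsto> (u L(t), t)\<close>.
\<close>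

lemma compact_moving_domain_slab:
  fixes L :: "real \<Rightarrow> real"
  assumes "continuous_on {a..b} L" and "\<And>t. \<lbrakk>a \<le> t; t \<le> b\<rbrakk> \<Longrightarrow> L t > 0"
  shows "compact {(x, t). a \<le> t \<and> t \<le> b \<and> 0 \<le> x \<and> x \<le> L t}" (is "compact ?S")
proof -
  have eq: "?S = (\<lambda>(u, t). (u * L t, t)) ` ({0..1} \<times> {a..b})"
  proof (intro equalityI subsetI)
    fix p assume "p \<in> ?S"
    then obtain x t where p: "p = (x, t)" "a \<le> t" "t \<le> b" "0 \<le> x" "x \<le> L t" by auto
    have "L t > 0" using assms(2) p by simp
    then have "p = (\<lambda>(u, t). (u * L t, t)) (x / L t, t)" "(x / L t, t) \<in> {0..1} \<times> {a..b}"
      using p by auto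
    then show "p \<in> (\<lambda>(u, t). (u * L t, t)) ` ({0..1} \<times> {a..b})" by blast
  next
    fix p assume "p \<in> (\<lambda>(u, t). (u * L t, t)) ` ({0..1} \<times> {a..b})"
    then show "p \<in> ?S"
      using assms(2) by (auto intro!: mult_left_le_one_le simp: less_imp_le)
  qed
  have "continuous_on ({0..1} \<times> {a..b}) (\<lambda>(u, t). (u * L t, t))"
    unfolding case_prod_beta
    by (intro continuous_intros continuous_on_compose2[OF assms(1) continuous_on_snd]) auto
  then show ?thesis
    unfolding eq by (rule compact_continuous_image) (intro compact_Times compact_Icc)
qed

text \<open>
  First-touching argument. If \<open>\<psi>\<close> ever reaches \<open>w\<close>, there is an earliest time at which it does, and
  the touching point is interior because \<open>w\<close> is positive on the boundary. There
  \<open>\<psi>\<^sub>x\<^sub>x \<le> w\<^sub>x\<^sub>x\<close> and the values of \<open>f\<close> agree, so \<open>\<psi>\<^sub>t < w\<^sub>t\<close>; but then \<open>\<psi>\<close> exceeded \<open>w\<close> just before.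
  As the inequality for \<open>w\<close> is strict, no regularity of \<open>f\<close> is needed.
\<close>

lemma strict_comparison:
  fixes w wt wx wxx :: "real \<Rightarrow> real \<Rightarrow> real"
  assumes "D > 0" and sol: "is_solution D f L \<psi>"
    and contL: "continuous_on {0..} L" and Lpos: "\<And>t. t \<ge> 0 \<Longrightarrow> L t > 0" and "T \<ge> 0"
    and contw: "continuous_on UNIV (\<lambda>(x, t). w x t)"
    and wt: "\<And>x t. ((\<lambda>s. w x s) has_real_derivative wt x t) (at t)"
    and wx: "\<And>x t. ((\<lambda>y. w y t) has_real_derivative wx x t) (at x)"
    and wxx: "\<And>x t. ((\<lambda>y. wx y t) has_real_derivative wxx x t) (at x)"
    and super: "\<And>x t. \<lbrakk>t > T; 0 < x; x < L t\<rbrakk> \<Longrightarrow> D * wxx x t + f (w x t) < wt x t"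
    and init: "\<And>x. \<lbrakk>0 \<le> x; x \<le> L T\<rbrakk> \<Longrightarrow> \<psi> x T < w x T"
    and bdry: "\<And>t. t \<ge> T \<Longrightarrow> w 0 t > 0 \<and> w (L t) t > 0"
    and "t1 \<ge> T" "0 \<le> x1" "x1 \<le> L t1"
  shows "\<psi> x1 t1 < w x1 t1"
proof (rule ccontr)
  assume neg: "\<not> \<psi> x1 t1 < w x1 t1"
  \<comment> \<open>\<open>Z\<close> is the compact set of points up to time \<open>t1\<close> at which the inequality fails.\<close>
  define S where "S = {(x, t). T \<le> t \<and> t \<le> t1 \<and> 0 \<le> x \<and> x \<le> L t}"
  define g where "g = (\<lambda>(x, t). \<psi> x t - w x t)"
  define Z where "Z = S \<inter> g -` {0..}"
  have "compact S" unfolding S_def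
    using contL Lpos \<open>T \<ge> 0\<close> by (intro compact_moving_domain_slab) (auto elim: continuous_on_subset)
  have cont\<psi>: "continuous_on (moving_domain L) (\<lambda>(x, t). \<psi> x t)"
    using sol by (simp add: is_solution_def)
  have contg: "continuous_on (moving_domain L) g"
    unfolding g_def using continuous_on_diff[OF cont\<psi> continuous_on_subset[OF contw subset_UNIV]]
    by (simp add: case_prod_beta)
  have "S \<subseteq> moving_domain L" using \<open>T \<ge> 0\<close> by (auto simp: S_def moving_domain_def)
  then have "closed Z" unfolding Z_def
    using continuous_closed_preimage[OF continuous_on_subset[OF contg]] \<open>compact S\<close>
      compact_imp_closed closed_atLeast by blast
  then have "compact Z" unfolding Z_def
    using compact_Int_closed[OF \<open>compact S\<close>] by fastforce
  moreover have "(x1, t1) \<in> Z" using assms neg by (auto simp: Z_def S_def g_def)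
  ultimately obtain p where p: "p \<in> Z" and pmin: "\<And>q. q \<in> Z \<Longrightarrow> snd p \<le> snd q"
    using continuous_attains_inf[of Z snd] continuous_on_snd[OF continuous_on_id] by fastforce
  obtain x0 t0 where p_eq: "p = (x0, t0)" by (cases p)
  have dom0: "T \<le> t0" "t0 \<le> t1" "0 \<le> x0" "x0 \<le> L t0" and ge0: "\<psi> x0 t0 \<ge> w x0 t0"
    using p by (auto simp: Z_def S_def g_def p_eq)
  have before: "\<psi> x t < w x t" if "T \<le> t" "t < t0" "0 \<le> x" "x \<le> L t" for x t
  proof (rule ccontr)
    assume "\<not> \<psi> x t < w x t"
    then have "(x, t) \<in> Z" using that dom0 by (auto simp: Z_def S_def g_def)
    then show False using pmin[of "(x, t)"] that p_eq by simp
  qed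
  have "t0 > T" using init[of x0] dom0 ge0 by (cases "t0 = T") auto
  have "\<psi> 0 t0 = 0" "\<psi> (L t0) t0 = 0"
    using sol dom0 \<open>T \<ge> 0\<close> by (auto simp: is_solution_def)
  then have "x0 \<noteq> 0" "x0 \<noteq> L t0"
    using bdry[of t0] dom0 ge0 by auto
  then have x0: "0 < x0" "x0 < L t0" using dom0 by auto
  have "t0 > 0" using \<open>t0 > T\<close> \<open>T \<ge> 0\<close> by simp
  \<comment> \<open>An interior point at time \<open>t0\<close> lies in the domain shortly before, though the boundary moves.\<close>
  have inside: "\<forall>\<^sub>F t in at_left t0. T < t \<and> t < t0 \<and> x < L t" if "0 < x" "x < L t0" for x
  proof -
    have "isCont L t0"
      using continuous_on_interior[OF contL] \<open>t0 > 0\<close> by simp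
    then have "(L \<longlongrightarrow> L t0) (at_left t0)"
      by (simp add: isCont_def filterlim_at_split)
    then have "\<forall>\<^sub>F t in at_left t0. x < L t" using that by (intro order_tendstoD)
    moreover have "\<forall>\<^sub>F t in at_left t0. t \<in> {T<..<t0}"
      using \<open>t0 > T\<close> by (intro eventually_at_leftI[of T]) auto
    ultimately show ?thesis by eventually_elim auto
  qed
  obtain \<psi>t \<psi>x \<psi>xx where der: "\<And>x t. \<lbrakk>t > 0; 0 < x; x < L t\<rbrakk> \<Longrightarrow>
        ((\<lambda>s. \<psi> x s) has_real_derivative \<psi>t x t) (at t) \<and>
        ((\<lambda>y. \<psi> y t) has_real_derivative \<psi>x x t) (at x) \<and>
        ((\<lambda>y. \<psi>x y t) has_real_derivative \<psi>xx x t) (at x) \<and>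
        \<psi>t x t = D * \<psi>xx x t + f (\<psi> x t)"
    using sol unfolding is_solution_def by (metis greaterThanLessThan_iff)
  have dt: "((\<lambda>s. \<psi> x s - w x s) has_real_derivative \<psi>t x t0 - wt x t0) (at t0)"
    if "0 < x" "x < L t0" for x
    using der[OF \<open>t0 > 0\<close> that] wt by (auto intro: DERIV_diff)
  have le: "\<psi> x t0 \<le> w x t0" if "0 < x" "x < L t0" for x
  proof -
    have "((\<lambda>s. \<psi> x s - w x s) \<longlongrightarrow> \<psi> x t0 - w x t0) (at_left t0)"
      using DERIV_isCont[OF dt[OF that]] by (simp add: isCont_def filterlim_at_split)
    moreover have "\<forall>\<^sub>F t in at_left t0. \<psi> x t - w x t \<le> 0"
      using inside[OF that]
    proof eventually_elim
      case (elim t)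
      then show ?case using before[of t x] that by simp
    qed
    ultimately have "\<psi> x t0 - w x t0 \<le> 0"
      by (intro tendsto_upperbound) auto
    then show ?thesis by simp
  qed
  have eq0: "\<psi> x0 t0 = w x0 t0" using le[OF x0] ge0 by simp
  have "\<psi>xx x0 t0 - wxx x0 t0 \<le> 0"
  proof (rule local_max_second_derivative_nonpos[OF x0])
    show "((\<lambda>y. \<psi> y t0 - w y t0) has_real_derivative \<psi>x x t0 - wx x t0) (at x)"
      if "0 < x" "x < L t0" for x
      using der[OF \<open>t0 > 0\<close> that] wx by (auto intro: DERIV_diff)
    show "((\<lambda>y. \<psi>x y t0 - wx y t0) has_real_derivative \<psi>xx x0 t0 - wxx x0 t0) (at x0)"
      using der[OF \<open>t0 > 0\<close> x0] wxx by (auto intro: DERIV_diff)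
    show "\<psi> x t0 - w x t0 \<le> \<psi> x0 t0 - w x0 t0" if "0 < x" "x < L t0" for x
      using le[OF that] eq0 by simp
  qed
  then have "D * \<psi>xx x0 t0 \<le> D * wxx x0 t0" using \<open>D > 0\<close> by simp
  then have "\<psi>t x0 t0 - wt x0 t0 < 0"
    using der[OF \<open>t0 > 0\<close> x0] super[OF \<open>t0 > T\<close> x0] eq0 by simp
  from DERIV_neg_dec_left[OF dt[OF x0] this] obtain d where "d > 0"
    and d: "\<And>h. \<lbrakk>0 < h; h < d\<rbrakk> \<Longrightarrow> \<psi> x0 t0 - w x0 t0 < \<psi> x0 (t0 - h) - w x0 (t0 - h)"
    by blast
  have "\<forall>\<^sub>F t in at_left t0. t \<in> {t0 - d<..<t0}"
    using \<open>d > 0\<close> by (intro eventually_at_leftI[of "t0 - d"]) auto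
  then have "\<forall>\<^sub>F t in at_left t0. False"
    using inside[OF x0]
  proof eventually_elim
    case (elim t)
    then show False
      using before[of t x0] d[of "t0 - t"] x0 eq0 by simp
  qed
  then show False by simp
qed

section \<open>A stationary profile for slightly supercritical lengths\<close>

text \<open>
  Strict sublinearity near zero propagates to all positive arguments because \<open>f(k) / k\<close> is
  non-increasing.
\<close>

lemma KPP_strictly_sublinear:
  assumes "KPP_type f r" and "k0 > 0" and "\<And>k. \<lbrakk>0 < k; k < k0\<rbrakk> \<Longrightarrow> f k < r * k" and "k > 0"
  shows "f k / k < r"
proof -
  define m where "m = min k (k0 / 2)"
  have m: "0 < m" "m \<le> k" "m < k0" using assms(2,4) by (auto simp: m_def)
  have "antimono_on {0<..} (\<lambda>k. f k / k)" using assms(1) by (simp add: KPP_type_def)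
  from monotone_onD[OF this, of m k] have "f k / k \<le> f m / m" using assms(4) m by simp
  also have "\<dots> < r" using assms(3)[OF m(1,3)] m by (simp add: field_simps)
  finally show ?thesis .
qed

text \<open>
  The perturbed neutral mode \<open>\<phi>\<close>. For \<open>\<beta> = \<pi> / L\<^sub>c\<^sub>r\<^sub>i\<^sub>t\<close> the correction equals \<open>s / 2 > 0\<close> at both
  ends of the critical interval, which keeps \<open>\<phi>\<close> positive a little beyond it.
\<close>

definition profile :: "real \<Rightarrow> real \<Rightarrow> real \<Rightarrow> real" where
  "profile \<beta> s x = sin (\<beta> * x) + s * (1 / 2 - 2 * (sin (\<beta> * x))\<^sup>2)"

text \<open>The derivative of the profile with respect to \<open>x\<close>.\<close>

definition profile' :: "real \<Rightarrow> real \<Rightarrow> real \<Rightarrow> real" where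
  "profile' \<beta> s x = \<beta> * cos (\<beta> * x) * (1 - 4 * s * sin (\<beta> * x))"

lemma profile_derivative: "(profile \<beta> s has_real_derivative profile' \<beta> s x) (at x)"
  unfolding profile_def profile'_def
  by (auto intro!: derivative_eq_intros simp: algebra_simps power2_eq_square)

lemma profile_second_derivative:
  "(profile' \<beta> s has_real_derivative
     \<beta>\<^sup>2 * (s * (6 * (sin (\<beta> * x))\<^sup>2 - 7 / 2) - profile \<beta> s x)) (at x)"
proof -
  have "(profile' \<beta> s has_real_derivative
     - (\<beta>\<^sup>2 * sin (\<beta> * x)) * (1 - 4 * s * sin (\<beta> * x)) - 4 * s * \<beta>\<^sup>2 * (cos (\<beta> * x))\<^sup>2) (at x)"
    unfolding profile'_def
    by (auto intro!: derivative_eq_intros simp: algebra_simps power2_eq_square)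
  also have "- (\<beta>\<^sup>2 * sin (\<beta> * x)) * (1 - 4 * s * sin (\<beta> * x)) - 4 * s * \<beta>\<^sup>2 * (cos (\<beta> * x))\<^sup>2
      = \<beta>\<^sup>2 * (s * (6 * (sin (\<beta> * x))\<^sup>2 - 7 / 2) - profile \<beta> s x)"
    unfolding profile_def cos_squared_eq by (simp add: algebra_simps power2_eq_square)
  finally show ?thesis .
qed

lemma profile_le: "0 \<le> s \<Longrightarrow> s \<le> 1 \<Longrightarrow> profile \<beta> s x \<le> 2"
proof -
  assume s: "0 \<le> s" "s \<le> 1"
  have "s * (1 / 2 - 2 * (sin (\<beta> * x))\<^sup>2) \<le> s * (1 / 2)"
    using s by (intro mult_left_mono) auto
  then show ?thesis unfolding profile_def using s sin_le_one[of "\<beta> * x"] by linarith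
qed

text \<open>
  The hypothesis admits slightly negative values of the sine, which occur on intervals slightly
  longer than the critical one.
\<close>

lemma profile_ge:
  assumes s: "0 \<le> s" "s \<le> 1 / 10" and C: "sin (\<beta> * x) \<ge> - s / 8"
  shows "profile \<beta> s x \<ge> s / 4"
proof -
  define C where "C = sin (\<beta> * x)"
  have C: "- s / 8 \<le> C" "C \<le> 1" using C by (auto simp: C_def)
  show ?thesis
  proof (cases "C \<le> 0")
    case True
    have "C\<^sup>2 \<le> (1 / 80)\<^sup>2" using C s True by (intro abs_le_square_iff[THEN iffD1]) auto
    also have "(1 / 80)\<^sup>2 \<le> (1 / 16 :: real)" by (simp add: power2_eq_square)
    finally have "s * (1 / 2 - 2 * C\<^sup>2) \<ge> s * (3 / 8)" 
      using s by (intro mult_left_mono) auto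
    then show ?thesis unfolding profile_def C_def[symmetric] using C by simp
  next
    case False
    have "C\<^sup>2 \<le> C" using C False by (simp add: power2_eq_square mult_left_le)
    then have "s * C\<^sup>2 \<le> 1 / 10 * C" using s False by (intro mult_mono) auto
    then have "s * (1 / 2 - 2 * C\<^sup>2) \<ge> s / 2 - C / 5" unfolding right_diff_distrib by simp
    then show ?thesis unfolding profile_def C_def[symmetric] using s False by linarith
  qed
qed

lemma profile_ge_half:
  assumes s: "0 \<le> s" "s \<le> 1 / 10" and C: "sin (\<beta> * x) \<ge> 3 / 4"
  shows "profile \<beta> s x \<ge> 1 / 2"
proof -
  have "(sin (\<beta> * x))\<^sup>2 \<le> 1" by (simp add: abs_square_le_1)
  then have "s * (1 / 2 - 2 * (sin (\<beta> * x))\<^sup>2) \<ge> s * (- 3 / 2)"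
    using s by (intro mult_left_mono) auto
  then show ?thesis unfolding profile_def using s C by simp
qed

text \<open>
  When \<open>D \<beta>\<^sup>2 = r\<close>, the first summand is \<open>D (A \<phi>)''\<close> by \<open>profile_second_derivative\<close>. The constants \<open>s\<close>
  and \<open>c\<close> depend on \<open>\<epsilon>\<close> through \<open>\<kappa>\<close>, but not on the amplitude \<open>A\<close>.
\<close>

lemma profile_supersolution:
  assumes kpp: "KPP_type f r" and sub: "\<And>k. k > 0 \<Longrightarrow> f k / k < r"
    and "\<epsilon> > 0" and "A \<ge> \<epsilon>"
    and \<kappa>: "\<kappa> = r - f (\<epsilon> / 2) / (\<epsilon> / 2)"
    and s: "0 < s" "s \<le> 1 / 10" "10 * r * s \<le> \<kappa>"
    and C: "sin (\<beta> * x) \<ge> - s / 8"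
    and c: "c \<le> \<kappa> / 8" "c \<le> r * s / 16"
  shows "A * (r * (s * (6 * (sin (\<beta> * x))\<^sup>2 - 7 / 2) - profile \<beta> s x)) + f (A * profile \<beta> s x)
         \<le> - c * A * profile \<beta> s x"
proof -
  define C where "C = sin (\<beta> * x)"
  define \<phi> where "\<phi> = profile \<beta> s x"
  have C: "- s / 8 \<le> C" "C \<le> 1" using C by (auto simp: C_def)
  have "r > 0" using kpp by (simp add: KPP_type_def)
  have "A > 0" using assms by simp
  have \<phi>2: "\<phi> \<le> 2" unfolding \<phi>_def using s by (intro profile_le) auto
  have "\<phi> \<ge> s / 4" unfolding \<phi>_def using s C by (intro profile_ge) (auto simp: C_def)
  then have "\<phi> > 0" using s by simp
  then have "A * \<phi> > 0" using \<open>A > 0\<close> by simp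
  have "\<kappa> > 0" using sub[of "\<epsilon> / 2"] \<open>\<epsilon> > 0\<close> \<kappa> by simp
  define q where "q = f (A * \<phi>) / (A * \<phi>)"
  have fq: "f (A * \<phi>) = q * (A * \<phi>)" using \<open>A * \<phi> > 0\<close> q_def
    nonzero_eq_divide_eq[of "A * \<phi>" q] by auto
  have "s * (r * (6 * C\<^sup>2 - 7 / 2)) + (q - r) * \<phi> \<le> - c * \<phi>"
  proof (cases "C \<ge> 3 / 4")
    case True
    \<comment> \<open>In the middle the nonlinear gap \<open>\<kappa>\<close> pays for the wrong sign of the linear part.\<close>
    have "\<phi> \<ge> 1 / 2" unfolding \<phi>_def using s True by (intro profile_ge_half) (auto simp: C_def)
    then have "\<epsilon> * (1 / 2) \<le> A * \<phi>" using \<open>A \<ge> \<epsilon>\<close> \<open>\<epsilon> > 0\<close> by (intro mult_mono) auto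
    moreover have mono: "antimono_on {0<..} (\<lambda>k. f k / k)" using kpp by (simp add: KPP_type_def)
    ultimately have "q \<le> f (\<epsilon> / 2) / (\<epsilon> / 2)" unfolding q_def
      using monotone_onD[OF mono, of "\<epsilon> / 2" "A * \<phi>"] \<open>\<epsilon> > 0\<close> \<open>A * \<phi> > 0\<close> by simp
    then have "(q - r) * \<phi> \<le> - \<kappa> * \<phi>" using \<kappa> \<open>\<phi> > 0\<close> by (intro mult_right_mono) auto
    moreover have "C\<^sup>2 \<le> 1" using C True by (simp add: abs_square_le_1)
    then have "s * (r * (6 * C\<^sup>2 - 7 / 2)) \<le> s * (r * (5 / 2))"
      using s \<open>r > 0\<close> by (intro mult_left_mono) auto
    moreover have "s * (r * (5 / 2)) \<le> \<kappa> / 4" using s(3) by (simp add: algebra_simps)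
    moreover have "\<kappa> * (1 / 2) \<le> \<kappa> * \<phi>" using \<open>\<kappa> > 0\<close> \<open>\<phi> \<ge> 1 / 2\<close> by (intro mult_left_mono) auto
    moreover have "c * \<phi> \<le> \<kappa> / 8 * \<phi>" using c \<open>\<phi> > 0\<close> by (intro mult_right_mono) auto
    ultimately show ?thesis using \<open>\<kappa> > 0\<close> by linarith
  next
    case False
    \<comment> \<open>Near the ends the linear part alone is negative, since \<open>6 (3/4)\<^sup>2 - 7/2 = - 1/8\<close>.\<close>
    have "C\<^sup>2 \<le> (3 / 4)\<^sup>2" using C s False by (intro abs_le_square_iff[THEN iffD1]) auto
    then have "6 * C\<^sup>2 - 7 / 2 \<le> - 1 / 8" by (simp add: power2_eq_square)
    then have "(s * r) * (6 * C\<^sup>2 - 7 / 2) \<le> (s * r) * (- 1 / 8)"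
      using s \<open>r > 0\<close> by (intro mult_left_mono) auto
    moreover have "(q - r) * \<phi> \<le> 0"
      using sub[OF \<open>A * \<phi> > 0\<close>] \<open>\<phi> > 0\<close> by (simp add: q_def mult_nonpos_nonneg)
    moreover have "c * \<phi> \<le> (r * s / 16) * \<phi>" using c \<open>\<phi> > 0\<close> by (intro mult_right_mono) auto
    moreover have "(r * s / 16) * \<phi> \<le> (r * s / 16) * 2"
      using \<phi>2 s \<open>r > 0\<close> by (intro mult_left_mono) auto
    ultimately show ?thesis by (simp add: algebra_simps)
  qed
  then have "A * (s * (r * (6 * C\<^sup>2 - 7 / 2)) + (q - r) * \<phi>) \<le> A * (- c * \<phi>)"
    using \<open>A > 0\<close> by (intro mult_left_mono) auto
  then show ?thesis unfolding \<phi>_def[symmetric] C_def[symmetric] fq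
    by (simp add: algebra_simps)
qed

lemma sin_ge_beyond_pi:
  assumes "0 \<le> y" "y \<le> pi + d" "0 \<le> d"
  shows "sin y \<ge> - d"
proof (cases "y \<le> pi")
  case True
  then show ?thesis using sin_ge_zero[of y] assms by linarith
next
  case False
  have "sin (y - pi) \<le> y - pi" using False by (intro sin_x_le_x) simp
  then show ?thesis using assms by simp
qed

section \<open>Decay to zero\<close>

theorem proposition4p2:
  fixes D r :: real and f L :: "real \<Rightarrow> real" and \<psi> :: "real \<Rightarrow> real \<Rightarrow> real"
  assumes "D > 0"
    and "twice_continuously_differentiable_on L {0..}"
    and "\<forall>t\<ge>0. L t > 0"
    and "KPP_type f r"
    and "\<exists>k0>0. \<forall>k. 0 < k \<and> k < k0 \<longrightarrow> f k < r * k"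
    and "is_solution D f L \<psi>"
    and "\<forall>(x, t) \<in> moving_domain L. \<psi> x t \<ge> 0"
    and "Limsup at_top (\<lambda>t. ereal (L t)) \<le> ereal (L_crit D r)"
  shows "\<forall>\<epsilon>>0. \<forall>\<^sub>F t in at_top. \<forall>x\<in>{0..L t}. \<bar>\<psi> x t\<bar> < \<epsilon>"
proof (intro allI impI)
  fix \<epsilon> :: real assume "\<epsilon> > 0"
  have "r > 0" using assms(4) by (simp add: KPP_type_def)
  obtain k0 where "k0 > 0" "\<And>k. \<lbrakk>0 < k; k < k0\<rbrakk> \<Longrightarrow> f k < r * k" using assms(5) by blast
  then have sub: "f k / k < r" if "k > 0" for k
    using KPP_strictly_sublinear[OF assms(4)] that by blast
  have contL: "continuous_on {0..} L"
    using assms(2) unfolding twice_continuously_differentiable_on_def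
    by (auto intro: DERIV_continuous_on)
  define \<beta> where "\<beta> = sqrt (r / D)"
  have "\<beta> > 0" and \<beta>2: "D * \<beta>\<^sup>2 = r" and \<beta>L: "\<beta> * L_crit D r = pi"
    using \<open>D > 0\<close> \<open>r > 0\<close> by (auto simp: \<beta>_def L_crit_def real_sqrt_mult[symmetric])
  \<comment> \<open>The supersolution is built for \<open>\<epsilon> / 4\<close>: the profile is at most \<open>2\<close>, which leaves the limit
    \<open>\<epsilon> / 2\<close> for the bound.\<close>
  define \<kappa> where "\<kappa> = r - f (\<epsilon> / 4 / 2) / (\<epsilon> / 4 / 2)"
  have "\<kappa> > 0" using sub[of "\<epsilon> / 4 / 2"] \<open>\<epsilon> > 0\<close> by (simp add: \<kappa>_def)
  define s where "s = min (1 / 10) (\<kappa> / (10 * r))"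
  have s: "0 < s" "s \<le> 1 / 10" "10 * r * s \<le> \<kappa>"
    using \<open>\<kappa> > 0\<close> \<open>r > 0\<close> by (auto simp: s_def min_def field_simps)
  define c where "c = min (\<kappa> / 8) (r * s / 16)"
  have c: "c > 0" "c \<le> \<kappa> / 8" "c \<le> r * s / 16"
    using \<open>\<kappa> > 0\<close> \<open>r > 0\<close> s by (auto simp: c_def)
  \<comment> \<open>Then \<open>\<beta> (L_crit D r + \<delta>) = \<pi> + s / 8\<close>, so the sine is at least \<open>- s / 8\<close>, the range in which
    the profile is controlled.\<close>
  define \<delta> where "\<delta> = s / (8 * \<beta>)"
  have "\<delta> > 0" using s \<open>\<beta> > 0\<close> by (simp add: \<delta>_def)
  then have "ereal (L_crit D r) < ereal (L_crit D r + \<delta>)" by simp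
  then have "Limsup at_top (\<lambda>t. ereal (L t)) < ereal (L_crit D r + \<delta>)"
    using assms(8) le_less_trans by blast
  then have "\<forall>\<^sub>F t in at_top. ereal (L t) < ereal (L_crit D r + \<delta>)"
    by (rule Limsup_lessD)
  then have "\<forall>\<^sub>F t in at_top. L t < L_crit D r + \<delta> \<and> t \<ge> 0"
    using eventually_ge_at_top[of 0] by eventually_elim simp
  then obtain T where T: "\<And>t. t \<ge> T \<Longrightarrow> L t < L_crit D r + \<delta> \<and> t \<ge> 0"
    unfolding eventually_at_top_linorder by blast
  then have "T \<ge> 0" by blast
  have C: "sin (\<beta> * x) \<ge> - s / 8" if "t \<ge> T" "0 \<le> x" "x \<le> L t" for x t
  proof -
    have "\<beta> * x \<le> \<beta> * (L_crit D r + \<delta>)" using T[OF that(1)] that \<open>\<beta> > 0\<close> by simp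
    also have "\<dots> = pi + s / 8" using \<beta>L \<open>\<beta> > 0\<close> by (simp add: distrib_left \<delta>_def)
    finally show ?thesis using sin_ge_beyond_pi[of "\<beta> * x" "s / 8"] that s \<open>\<beta> > 0\<close> by simp
  qed
  have cont\<psi>: "continuous_on (moving_domain L) (\<lambda>(x, t). \<psi> x t)"
    using assms(6) by (simp add: is_solution_def)
  have "continuous_on {0..L T} (\<lambda>x. \<psi> x T)"
  proof -
    have "continuous_on {0..L T} (\<lambda>x. (x, T))" by (intro continuous_intros)
    moreover have "(\<lambda>x. (x, T)) ` {0..L T} \<subseteq> moving_domain L"
      using \<open>T \<ge> 0\<close> by (auto simp: moving_domain_def)
    ultimately show ?thesis using continuous_on_compose2[OF cont\<psi>] by fastforce
  qed
  then have "bounded ((\<lambda>x. \<psi> x T) ` {0..L T})"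
    by (intro compact_imp_bounded compact_continuous_image) auto
  then obtain M where "M > 0" and M: "\<And>x. x \<in> {0..L T} \<Longrightarrow> \<bar>\<psi> x T\<bar> \<le> M"
    unfolding bounded_pos by auto
  \<comment> \<open>The factor \<open>4 / s\<close> offsets the lower bound \<open>s / 4\<close> of the profile at the initial time \<open>T\<close>.\<close>
  define A where "A = (\<lambda>t. \<epsilon> / 4 + 4 * M / s * exp (- c * (t - T)))"
  have A_ge: "A t \<ge> \<epsilon> / 4" for t using \<open>M > 0\<close> s by (simp add: A_def)
  have A_pos: "A t > 0" for t using A_ge[of t] \<open>\<epsilon> > 0\<close> by linarith
  have A_der: "(A has_real_derivative - c * (A t - \<epsilon> / 4)) (at t)" for t
    unfolding A_def using s by (auto intro!: derivative_eq_intros)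
  have profile_pos: "profile \<beta> s x \<ge> s / 4" if "t \<ge> T" "0 \<le> x" "x \<le> L t" for x t
    using C[OF that] s by (intro profile_ge) auto
  have bound: "\<psi> x t < A t * profile \<beta> s x" if "t \<ge> T" "0 \<le> x" "x \<le> L t" for x t
  proof (rule strict_comparison[OF \<open>D > 0\<close> assms(6) contL _ \<open>T \<ge> 0\<close>, where
        wt = "\<lambda>x t. - c * (A t - \<epsilon> / 4) * profile \<beta> s x" and
        wx = "\<lambda>x t. A t * profile' \<beta> s x" and
        wxx = "\<lambda>x t. A t * (\<beta>\<^sup>2 * (s * (6 * (sin (\<beta> * x))\<^sup>2 - 7 / 2) - profile \<beta> s x))"])
    show "L t > 0" if "t \<ge> 0" for t using assms(3) that by simp
    show "continuous_on UNIV (\<lambda>(x, t). A t * profile \<beta> s x)"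
      unfolding A_def profile_def case_prod_beta by (intro continuous_intros)
    show "((\<lambda>t. A t * profile \<beta> s x) has_real_derivative
        - c * (A t - \<epsilon> / 4) * profile \<beta> s x) (at t)" for x t
      by (rule DERIV_cmult_right[OF A_der])
    show "((\<lambda>x. A t * profile \<beta> s x) has_real_derivative A t * profile' \<beta> s x) (at x)" for x t
      by (rule DERIV_cmult[OF profile_derivative])
    show "((\<lambda>x. A t * profile' \<beta> s x) has_real_derivative
        A t * (\<beta>\<^sup>2 * (s * (6 * (sin (\<beta> * x))\<^sup>2 - 7 / 2) - profile \<beta> s x))) (at x)" for x t
      by (rule DERIV_cmult[OF profile_second_derivative])
    show "D * (A t * (\<beta>\<^sup>2 * (s * (6 * (sin (\<beta> * x))\<^sup>2 - 7 / 2) - profile \<beta> s x)))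
        + f (A t * profile \<beta> s x) < - c * (A t - \<epsilon> / 4) * profile \<beta> s x"
      if "t > T" "0 < x" "x < L t" for x t
    proof -
      have "D * (A t * (\<beta>\<^sup>2 * (s * (6 * (sin (\<beta> * x))\<^sup>2 - 7 / 2) - profile \<beta> s x)))
          = A t * ((D * \<beta>\<^sup>2) * (s * (6 * (sin (\<beta> * x))\<^sup>2 - 7 / 2) - profile \<beta> s x))"
        by (simp only: ac_simps)
      moreover have "A t * (r * (s * (6 * (sin (\<beta> * x))\<^sup>2 - 7 / 2) - profile \<beta> s x))
          + f (A t * profile \<beta> s x) \<le> - c * A t * profile \<beta> s x"
        by (rule profile_supersolution[OF assms(4) sub _ A_ge \<kappa>_def s C[of t x] c(2,3)])
          (use that \<open>\<epsilon> > 0\<close> in auto)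
      moreover have "c * (\<epsilon> / 4) * profile \<beta> s x > 0"
        using profile_pos[of t x] that c s \<open>\<epsilon> > 0\<close> by simp
      moreover have "- c * (A t - \<epsilon> / 4) * profile \<beta> s x
          = - c * A t * profile \<beta> s x + c * (\<epsilon> / 4) * profile \<beta> s x"
        by (simp add: algebra_simps)
      ultimately show ?thesis unfolding \<beta>2 by linarith
    qed
    show "\<psi> x T < A T * profile \<beta> s x" if "0 \<le> x" "x \<le> L T" for x
    proof -
      have "M < A T * (s / 4)" using s \<open>\<epsilon> > 0\<close> by (simp add: A_def field_simps)
      also have "\<dots> \<le> A T * profile \<beta> s x"
        using profile_pos[OF order_refl that] A_pos[of T] by simp
      finally show ?thesis using M[of x] that by auto
    qed
    show "A t * profile \<beta> s 0 > 0 \<and> A t * profile \<beta> s (L t) > 0" if "t \<ge> T" for t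
      using profile_pos[OF that, of 0] profile_pos[OF that, of "L t"] A_pos[of t] s
        T[OF that] assms(3) by (auto intro!: mult_pos_pos simp: less_imp_le)
  qed (use that in auto)
  have "((\<lambda>t. 4 * M / s * exp (- c * (t - T))) \<longlongrightarrow> 0) at_top"
  proof (rule tendsto_mult_right_zero)
    have "filterlim (\<lambda>t. - T + t) at_top at_top"
      by (intro filterlim_tendsto_add_at_top[OF tendsto_const] filterlim_ident)
    then have "filterlim (\<lambda>t. c * (- T + t)) at_top at_top"
      using c(1) by (intro filterlim_tendsto_pos_mult_at_top[OF tendsto_const])
    then have "filterlim (\<lambda>t. - (c * (- T + t))) at_bot at_top"
      by (simp only: filterlim_uminus_at_top)
    from filterlim_compose[OF exp_at_bot this]
    show "((\<lambda>t. exp (- c * (t - T))) \<longlongrightarrow> 0) at_top" by simp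
  qed
  then have "\<forall>\<^sub>F t in at_top. 4 * M / s * exp (- c * (t - T)) < \<epsilon> / 4"
    using \<open>\<epsilon> > 0\<close> by (intro order_tendstoD) auto
  then show "\<forall>\<^sub>F t in at_top. \<forall>x\<in>{0..L t}. \<bar>\<psi> x t\<bar> < \<epsilon>"
    using eventually_ge_at_top[of T]
  proof eventually_elim
    case (elim t)
    show ?case
    proof
      fix x assume x: "x \<in> {0..L t}"
      have "\<psi> x t \<ge> 0" using assms(7) x T[of t] elim by (auto simp: moving_domain_def)
      moreover have "\<psi> x t < A t * profile \<beta> s x" using bound elim x by simp
      moreover have "A t * profile \<beta> s x \<le> A t * 2"
        using profile_le[of s \<beta> x] s A_pos[of t] by simp
      moreover have "A t < \<epsilon> / 2" using elim by (simp add: A_def)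
      ultimately show "\<bar>\<psi> x t\<bar> < \<epsilon>" by simp
    qed
  qed
qed

end
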